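(* Let $V$ be a finite set, let $m\ge 1$ be an integer, let $\mathbf r=(r(x,k)\colon x\in V,\ k\in\mathbb N)$ be a collection of positive numbers, and let $P$ be an irreducible stochastic matrix on $V$ with invariant law $\pi$. For any $f,g\colon\Omega\to\mathbb R$, $$\mathcal E_{\mathrm{zrp}(P,\mathbf r,m)}(f,g)=\sum_{\xi\in\widehat\Omega}\mu(\xi)\,\mathcal E_P(f_\xi,g_\xi),$$ where for $\xi\in\widehat\Omega$ the functions $f_\xi,g_\xi\colon V\to\mathbb R$ are defined by $f_\xi(x)=f(\xi+\delta_x)$ and $g_\xi(x)=g(\xi+\delta_x)$.
   Context: $\mathbb N=\{1,2,\dots\}$, $\mathbb Z_+=\{0,1,2,\dots\}$. $\Omega=\{\eta\in\mathbb Z_+^V\colon \sum_{x\in V}\eta(x)=m\}$ and $\widehat\Omega=\{\xi\in\mathbb Z_+^V\colon \sum_{x\in V}\xi(x)=m-1\}$; $(\delta_x)_{x\in V}$ is the canonical basis of $\mathbb R^V$; by convention $r(x,0)=0$ for all $x\in V$. The zero-range process $\mathrm{zrp}(P,\mathbf r,m)$ is the continuous-time Markov chain on $\Omega$ with generator $$(\mathcal L f)(\eta)=\sum_{(x,y)\in V^2} r(x,\eta(x))\,P(x,y)\,\bigl(f(\eta+\delta_y-\delta_x)-f(\eta)\bigr)$$ (terms with $\eta(x)=0$ being zero). Define, for every $\eta\in\mathbb Z_+^V$, $$\mu(\eta)=\frac1Z\prod_{x\in V}\prod_{k=1}^{\eta(x)}\frac{\pi(x)}{r(x,k)},$$ where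 $Z$ is the constant for which $\sum_{\eta\in\Omega}\mu(\eta)=1$; restricted to $\Omega$, $\mu$ is the stationary law of the process. The same $Z$ is used on $\widehat\Omega$, so $\mu$ need not have total mass $1$ there. The Dirichlet forms are $\mathcal E_{\mathrm{zrp}(P,\mathbf r,m)}(f,g)=-\sum_{\eta\in\Omega}\mu(\eta)f(\eta)(\mathcal L g)(\eta)$ and $\mathcal E_P(\phi,\psi)=\sum_{x\in V}\pi(x)\phi(x)((I-P)\psi)(x)$. No reversibility is assumed. *)

theory Defs
  imports "HOL-Analysis.Analysis"
begin

definition stochastic_matrix :: "real ^ 'v ^ 'v \<Rightarrow> bool" where
  "stochastic_matrix P \<longleftrightarrow> (\<forall>x y. P $ x $ y \<ge> 0) \<and> (\<forall>x. (\<Sum>y\<in>UNIV. P $ x $ y) = 1)"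

definition matrix_pow :: "real ^ 'v ^ 'v \<Rightarrow> nat \<Rightarrow> real ^ 'v ^ 'v" where
  "matrix_pow P n = ((\<lambda>A. A ** P) ^^ n) (mat 1)"

definition irreducible_matrix :: "real ^ 'v ^ 'v \<Rightarrow> bool" where
  "irreducible_matrix P \<longleftrightarrow> (\<forall>x y. \<exists>n. matrix_pow P n $ x $ y > 0)"

definition invariant_law :: "real ^ 'v ^ 'v \<Rightarrow> real ^ 'v \<Rightarrow> bool" where
  "invariant_law P \<pi> \<longleftrightarrow>
     (\<forall>x. \<pi> $ x \<ge> 0) \<and> (\<Sum>x\<in>UNIV. \<pi> $ x) = 1 \<and> \<pi> v* P = \<pi>"

definition chain_dirichlet ::
    "real ^ 'v ^ 'v \<Rightarrow> real ^ 'v \<Rightarrow> real ^ 'v \<Rightarrow> real ^ 'v \<Rightarrow> real" where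
  "chain_dirichlet P \<pi> \<phi> \<psi> = (\<Sum>x\<in>UNIV. \<pi> $ x * \<phi> $ x * ((mat 1 - P) *v \<psi>) $ x)"

definition configs :: "nat \<Rightarrow> (nat ^ 'v) set" where
  "configs m = {\<eta>. (\<Sum>x\<in>UNIV. \<eta> $ x) = m}"

text \<open>
  The basis vector at \<open>x\<close> is \<open>axis x 1\<close>. The subtraction of natural numbers truncates
  only if \<open>\<eta> $ x = 0\<close>; such terms vanish under the convention \<open>r x 0 = 0\<close>.
\<close>
definition zrp_generator ::
    "real ^ 'v ^ 'v \<Rightarrow> ('v \<Rightarrow> nat \<Rightarrow> real) \<Rightarrow> (nat ^ 'v \<Rightarrow> real) \<Rightarrow> nat ^ 'v \<Rightarrow> real" where
  "zrp_generator P r f \<eta> =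
     (\<Sum>(x, y)\<in>UNIV. r x (\<eta> $ x) * P $ x $ y * (f (\<eta> + axis y 1 - axis x 1) - f \<eta>))"

definition zrp_weight :: "real ^ 'v \<Rightarrow> ('v \<Rightarrow> nat \<Rightarrow> real) \<Rightarrow> nat ^ 'v \<Rightarrow> real" where
  "zrp_weight \<pi> r \<eta> = (\<Prod>x\<in>UNIV. \<Prod>k=1..\<eta> $ x. \<pi> $ x / r x k)"

definition zrp_const :: "real ^ 'v \<Rightarrow> ('v \<Rightarrow> nat \<Rightarrow> real) \<Rightarrow> nat \<Rightarrow> real" where
  "zrp_const \<pi> r m = (\<Sum>\<eta>\<in>configs m. zrp_weight \<pi> r \<eta>)"

text \<open>
  Defined on all configurations; the normalisation is the one for \<open>m\<close> particles whatever
  the number of particles in \<open>\<eta>\<close>.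
\<close>
definition zrp_measure ::
    "real ^ 'v \<Rightarrow> ('v \<Rightarrow> nat \<Rightarrow> real) \<Rightarrow> nat \<Rightarrow> nat ^ 'v \<Rightarrow> real" where
  "zrp_measure \<pi> r m \<eta> = 1 / zrp_const \<pi> r m * zrp_weight \<pi> r \<eta>"

definition zrp_dirichlet ::
    "real ^ 'v ^ 'v \<Rightarrow> real ^ 'v \<Rightarrow> ('v \<Rightarrow> nat \<Rightarrow> real) \<Rightarrow> nat \<Rightarrow>
     (nat ^ 'v \<Rightarrow> real) \<Rightarrow> (nat ^ 'v \<Rightarrow> real) \<Rightarrow> real" where
  "zrp_dirichlet P \<pi> r m f g =
     - (\<Sum>\<eta>\<in>configs m. zrp_measure \<pi> r m \<eta> * f \<eta> * zrp_generator P r g \<eta>)"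

lemma finite_configs: "finite (configs m :: (nat ^ 'v) set)"
proof (rule finite_subset)
  show "(configs m :: (nat ^ 'v) set) \<subseteq> vec_lambda ` (UNIV \<rightarrow>\<^sub>E {..m})"
  proof
    fix \<eta> :: "nat ^ 'v" assume "\<eta> \<in> configs m"
    then have "\<eta> $ x \<le> m" for x
      using member_le_sum[of x UNIV "\<lambda>x. \<eta> $ x"] by (simp add: configs_def)
    then have "vec_nth \<eta> \<in> UNIV \<rightarrow>\<^sub>E {..m}" by auto
    then show "\<eta> \<in> vec_lambda ` (UNIV \<rightarrow>\<^sub>E {..m})"
      by (metis image_eqI vec_nth_inverse)
  qed
  show "finite (vec_lambda ` (UNIV \<rightarrow>\<^sub>E {..m}) :: (nat ^ 'v) set)"
    by (intro finite_imageI finite_PiE) auto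
qed

lemma configs_nonempty: "(configs m :: (nat ^ 'v) set) \<noteq> {}"
proof -
  have "axis undefined m \<in> (configs m :: (nat ^ 'v) set)"
    by (simp add: configs_def axis_def)
  then show ?thesis by blast
qed

lemma matrix_pow_invariant:
  fixes \<pi> :: "real ^ 'v"
  assumes "\<pi> v* P = \<pi>"
  shows "\<pi> v* matrix_pow P n = \<pi>"
proof (induction n)
  case 0
  show ?case by (simp add: matrix_pow_def vector_matrix_mul_rid)
next
  case (Suc n)
  have "\<pi> v* (matrix_pow P n ** P) = (\<pi> v* matrix_pow P n) v* P"
    by (simp add: vector_matrix_mul_assoc)
  with Suc assms show ?case by (simp add: matrix_pow_def)
qed

lemma matrix_pow_nonneg:
  assumes "stochastic_matrix P"
  shows "matrix_pow P n $ x $ y \<ge> 0"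
proof (induction n arbitrary: x y)
  case 0
  show ?case by (simp add: matrix_pow_def mat_def)
next
  case (Suc n)
  have "matrix_pow P (Suc n) $ x $ y = (\<Sum>z\<in>UNIV. matrix_pow P n $ x $ z * P $ z $ y)"
    by (simp add: matrix_pow_def matrix_matrix_mult_def)
  also have "\<dots> \<ge> 0"
    using Suc assms by (intro sum_nonneg mult_nonneg_nonneg) (auto simp: stochastic_matrix_def)
  finally show ?case .
qed

lemma invariant_law_pos:
  assumes "stochastic_matrix P" "irreducible_matrix P" "invariant_law P \<pi>"
  shows "\<pi> $ y > 0"
proof -
  have nonneg: "\<pi> $ x \<ge> 0" for x
    using assms(3) by (simp add: invariant_law_def)
  have "\<exists>x. \<pi> $ x \<noteq> 0"
  proof (rule ccontr)
    assume "\<not> ?thesis"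
    then have "(\<Sum>x\<in>UNIV. \<pi> $ x) = 0" by simp
    with assms(3) show False by (simp add: invariant_law_def)
  qed
  then obtain x where x: "\<pi> $ x > 0" using nonneg by (metis less_le)
  obtain n where n: "matrix_pow P n $ x $ y > 0"
    using assms(2) by (auto simp: irreducible_matrix_def)
  have "0 < \<pi> $ x * matrix_pow P n $ x $ y" using x n by simp
  also have "\<dots> \<le> (\<Sum>z\<in>UNIV. \<pi> $ z * matrix_pow P n $ z $ y)"
    using nonneg matrix_pow_nonneg[OF assms(1)]
    by (intro member_le_sum) auto
  also have "\<dots> = (\<pi> v* matrix_pow P n) $ y"
    by (simp add: vector_matrix_mult_def mult.commute)
  also have "\<dots> = \<pi> $ y"
    using matrix_pow_invariant[of \<pi> P n] assms(3) by (simp add: invariant_law_def)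
  finally show ?thesis .
qed

lemma zrp_measure_sum:
  assumes "\<And>x k. k \<ge> 1 \<Longrightarrow> r x k > 0"
    and "stochastic_matrix P" "irreducible_matrix P" "invariant_law P \<pi>"
  shows "(\<Sum>\<eta>\<in>configs m. zrp_measure \<pi> r m \<eta>) = 1"
proof -
  have "zrp_weight \<pi> r \<eta> > 0" for \<eta>
    unfolding zrp_weight_def
    using assms(1) invariant_law_pos[OF assms(2-4)] by (intro prod_pos) auto
  then have "zrp_const \<pi> r m > 0"
    unfolding zrp_const_def by (intro sum_pos finite_configs configs_nonempty)
  then show ?thesis
    by (simp add: zrp_measure_def zrp_const_def flip: sum_divide_distrib)
qed

end

theory Submission
  imports Defs
begin

text \<open>
  Moving a particle from \<open>x\<close> to \<open>y\<close> turns \<open>\<xi> + \<delta>\<^sub>x\<close> into \<open>\<xi> + \<delta>\<^sub>y\<close>, where \<open>\<xi>\<close> records the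
  other \<open>m - 1\<close> particles. Substitute \<open>\<eta> = \<xi> + \<delta>\<^sub>x\<close> in the Dirichlet form, separately for each \<open>x\<close>;
  no term is lost because \<open>r x 0 = 0\<close>. The identity
  \<open>\<mu> (\<xi> + \<delta>\<^sub>x) r x (\<xi> x + 1) = \<pi> x \<mu> \<xi>\<close> then absorbs the rates, and for fixed \<open>\<xi>\<close> what
  remains is the Dirichlet form of the single-particle chain.
\<close>

text \<open>Only the product at site \<open>x\<close> changes: it gains the factor with
  \<open>k = Suc (\<xi> $ x)\<close>, whose denominator cancels the rate.\<close>

lemma zrp_weight_add_axis:
  fixes \<pi> :: "real ^ 'v"
  assumes "r x (Suc (\<xi> $ x)) \<noteq> 0"
  shows "zrp_weight \<pi> r (\<xi> + axis x 1) * r x (Suc (\<xi> $ x)) = \<pi> $ x * zrp_weight \<pi> r \<xi>"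
proof -
  have "(\<Prod>z\<in>UNIV - {x}. \<Prod>k=1..(\<xi> + axis x 1) $ z. \<pi> $ z / r z k) =
      (\<Prod>z\<in>UNIV - {x}. \<Prod>k=1..\<xi> $ z. \<pi> $ z / r z k)"
    by (rule prod.cong) (auto simp: axis_def)
  moreover have "(\<xi> + axis x 1) $ x = Suc (\<xi> $ x)"
    by (simp add: axis_def)
  ultimately show ?thesis
    using assms by (simp add: zrp_weight_def prod.remove[of UNIV x])
qed

text \<open>Adding a particle at \<open>x\<close> is a bijection from \<open>configs (m - 1)\<close>
  onto the configurations in \<open>configs m\<close> that occupy \<open>x\<close>; \<open>F\<close>
  vanishes on the others.\<close>

lemma sum_configs_remove_particle:
  fixes F :: "nat ^ 'v \<Rightarrow> real"
  assumes "m \<ge> 1" and "\<And>\<eta>. \<eta> $ x = 0 \<Longrightarrow> F \<eta> = 0"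
  shows "(\<Sum>\<eta>\<in>configs m. F \<eta>) = (\<Sum>\<xi>\<in>configs (m - 1). F (\<xi> + axis x 1))"
proof -
  have tot: "(\<Sum>z\<in>UNIV. (\<xi> + axis x 1) $ z) = Suc (\<Sum>z\<in>UNIV. \<xi> $ z)" for \<xi> :: "nat ^ 'v"
    by (simp add: sum.distrib axis_def)
  have restore: "\<eta> - axis x 1 + axis x 1 = \<eta>" if "\<eta> $ x \<noteq> 0" for \<eta> :: "nat ^ 'v"
    using that by (auto simp: vec_eq_iff axis_def)
  have "(\<Sum>\<eta>\<in>configs m. F \<eta>) = (\<Sum>\<eta>\<in>{\<eta> \<in> configs m. \<eta> $ x \<noteq> 0}. F \<eta>)"
    using assms(2) by (intro sum.mono_neutral_right finite_configs) auto
  also have "\<dots> = (\<Sum>\<xi>\<in>configs (m - 1). F (\<xi> + axis x 1))"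
  proof (rule sum.reindex_bij_witness[of _ "\<lambda>\<xi>. \<xi> + axis x 1" "\<lambda>\<eta>. \<eta> - axis x 1"])
    fix \<eta> :: "nat ^ 'v" assume \<eta>: "\<eta> \<in> {\<eta> \<in> configs m. \<eta> $ x \<noteq> 0}"
    then have "Suc (\<Sum>z\<in>UNIV. (\<eta> - axis x 1) $ z) = m"
      unfolding tot[symmetric] by (simp only: configs_def mem_Collect_eq restore not_False_eq_True)
    then show "\<eta> - axis x 1 \<in> configs (m - 1)"
      by (metis (mono_tags, lifting) configs_def diff_Suc_1 mem_Collect_eq)
  qed (use assms(1) tot restore in \<open>auto simp: configs_def\<close>)
  finally show ?thesis .
qed

text \<open>Rows of \<open>P\<close> sum to 1, so \<open>\<psi> $ x\<close> can be averaged over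
  \<open>y\<close>; this gives the same increments as in \<open>zrp_generator\<close>.\<close>

lemma chain_dirichlet_jumps:
  fixes P :: "real ^ 'v ^ 'v"
  assumes "stochastic_matrix P"
  shows "chain_dirichlet P \<pi> \<phi> \<psi> =
    - (\<Sum>x\<in>UNIV. \<Sum>y\<in>UNIV. \<pi> $ x * \<phi> $ x * P $ x $ y * (\<psi> $ y - \<psi> $ x))"
proof -
  have "((mat 1 - P) *v \<psi>) $ x = - (\<Sum>y\<in>UNIV. P $ x $ y * (\<psi> $ y - \<psi> $ x))" for x
    using assms
    by (simp add: matrix_vector_mult_diff_rdistrib stochastic_matrix_def right_diff_distrib
        sum_subtractf matrix_vector_mult_def[of P] flip: sum_distrib_right)
  then show ?thesis
    by (simp add: chain_dirichlet_def sum_distrib_left mult.assoc sum_negf)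
qed

theorem lemma11:
  fixes P :: "real ^ 'v ^ 'v" and \<pi> :: "real ^ 'v"
    and r :: "'v \<Rightarrow> nat \<Rightarrow> real" and m :: nat
    and f g :: "nat ^ 'v \<Rightarrow> real"
  assumes "m \<ge> 1"
    and "\<And>x k. k \<ge> 1 \<Longrightarrow> r x k > 0"
    and "\<And>x. r x 0 = 0"
    and "stochastic_matrix P"
    and "irreducible_matrix P"
    and "invariant_law P \<pi>"
  shows "zrp_dirichlet P \<pi> r m f g =
    (\<Sum>\<xi>\<in>configs (m - 1). zrp_measure \<pi> r m \<xi> *
       chain_dirichlet P \<pi> (\<chi> x. f (\<xi> + axis x 1)) (\<chi> x. g (\<xi> + axis x 1)))"
proof -
  \<comment> \<open>\<open>F x\<close> collects the jumps out of \<open>x\<close>, so that each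
    \<open>x\<close> can have its own substitution.\<close>
  define F where "F x \<eta> = (\<Sum>y\<in>UNIV. zrp_measure \<pi> r m \<eta> * f \<eta> *
      (r x (\<eta> $ x) * P $ x $ y * (g (\<eta> + axis y 1 - axis x 1) - g \<eta>)))" for x \<eta>
  have F: "F x (\<xi> + axis x 1) = zrp_measure \<pi> r m \<xi> * (\<Sum>y\<in>UNIV. \<pi> $ x * f (\<xi> + axis x 1) *
      P $ x $ y * (g (\<xi> + axis y 1) - g (\<xi> + axis x 1)))" for x \<xi>
  proof -
    \<comment> \<open>The subtraction does not truncate, as a particle at \<open>x\<close> has just
      been added.\<close>
    have move: "\<xi> + axis x 1 + axis y 1 - axis x 1 = \<xi> + axis y 1" for y
      by (simp add: vec_eq_iff)
    have "r x (Suc (\<xi> $ x)) \<noteq> 0"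
      using assms(2)[of "Suc (\<xi> $ x)" x] by simp
    \<comment> \<open>Both measures carry the constant for \<open>m\<close> particles, so the
      identity for weights passes to them.\<close>
    then have \<mu>: "zrp_measure \<pi> r m (\<xi> + axis x 1) * r x ((\<xi> + axis x 1) $ x) =
        \<pi> $ x * zrp_measure \<pi> r m \<xi>"
      using zrp_weight_add_axis[of r x \<xi> \<pi>] by (simp add: zrp_measure_def axis_def)
    have "zrp_measure \<pi> r m (\<xi> + axis x 1) * f (\<xi> + axis x 1) *
        (r x ((\<xi> + axis x 1) $ x) * p * d) =
        zrp_measure \<pi> r m \<xi> * (\<pi> $ x * f (\<xi> + axis x 1) * p * d)" for p d
      using arg_cong[OF \<mu>, of "\<lambda>c. c * (f (\<xi> + axis x 1) * p * d)"]
      by (simp only: mult_ac)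
    then show ?thesis
      unfolding F_def move sum_distrib_left by (simp only:)
  qed
  have "zrp_dirichlet P \<pi> r m f g = - (\<Sum>\<eta>\<in>configs m. \<Sum>x\<in>UNIV. F x \<eta>)"
    by (simp add: zrp_dirichlet_def zrp_generator_def F_def sum_distrib_left
        flip: sum.cartesian_product UNIV_Times_UNIV)
  also have "(\<Sum>\<eta>\<in>configs m. \<Sum>x\<in>UNIV. F x \<eta>) = (\<Sum>x\<in>UNIV. \<Sum>\<eta>\<in>configs m. F x \<eta>)"
    by (rule sum.swap)
  also have "\<dots> = (\<Sum>x\<in>UNIV. \<Sum>\<xi>\<in>configs (m - 1). F x (\<xi> + axis x 1))"
    using assms(1,3) by (intro sum.cong refl sum_configs_remove_particle) (simp_all add: F_def)
  also have "\<dots> = (\<Sum>\<xi>\<in>configs (m - 1). \<Sum>x\<in>UNIV. F x (\<xi> + axis x 1))"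
    by (rule sum.swap)
  finally show ?thesis
    by (simp only: F chain_dirichlet_jumps[OF assms(4)] vec_lambda_beta mult_minus_right sum_negf
        flip: sum_distrib_left)
qed

end
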